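(* Let $\langle(p^{(t)},\Omega_t)\mid t\in\mathbb{N}^0\rangle$ be a linear dynamic optimization (LDO) problem on $X=[0,b]$, $b>0$, let $x\in X$ and let $\langle x_t\mid t\in\mathbb{N}^0\rangle\in\mathcal{F}(x)$. If there is a sequence $\langle q_t\mid t\in\mathbb{N}^0\rangle$ of non-negative real numbers satisfying (i) for all $t\in\mathbb{N}^0$: $p^{(t)}x_t+q_{t+1}x_{t+1}-q_tx_t\ \ge\ p^{(t)}y+q_{t+1}z-q_ty$ for all $(y,z)\in\Omega_t$, (ii) $\lim_{t\to\infty}q_tx_t=0$, then $\langle x_t\mid t\in\mathbb{N}^0\rangle\in\mathcal{S}(x)$.
   Context: $\mathbb{N}^0=\{0,1,2,\dots\}$. An LDO problem $\langle(p^{(t)},\Omega_t)\mid t\in\mathbb{N}^0\rangle$ on $X=[0,b]$ consists of a sequence of real numbers $p^{(t)}$ with $\sum_{t=0}^\infty|p^{(t)}|<+\infty$ and sets $\Omega_t\subset X\times X$ such that for every $t\in\mathbb{N}^0$: (i) $\Omega_t$ is non-empty, closed and convex; (ii) for every $x\in X$ there is $y\in X$ with $(x,y)\in\Omega_t$. For $x\in X$, $\mathcal{F}(x)$ is the set of sequences $\langle x_t\mid t\in\mathbb{N}^0\rangle$ in $X$ with $x_0=x$ and $(x_t,x_{t+1})\in\Omega_t$ for all $t\in\mathbb{N}^0$; $\mathcal{S}(x)$ is the set of $\langle x_t\rangle\in\mathcal{F}(x)$ with $\sum_{t=0}^\infty p^{(t)}x_t\ge\sum_{t=0}^\infty p^{(t)}y_t$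 for all $\langle y_t\rangle\in\mathcal{F}(x)$. *)

theory Defs
  imports "HOL-Analysis.Analysis"
begin

text \<open>
  Linear dynamic optimization (LDO) problems on \<open>X = {0..b}\<close>. Since \<open>X \<times> X\<close> is closed,
  being closed in \<open>X \<times> X\<close> and in the plane is the same for subsets of \<open>X \<times> X\<close>.
\<close>

definition LDO_problem :: "real \<Rightarrow> (nat \<Rightarrow> real) \<Rightarrow> (nat \<Rightarrow> (real \<times> real) set) \<Rightarrow> bool" where
  "LDO_problem b p \<Omega> \<longleftrightarrow>
     summable (\<lambda>t. \<bar>p t\<bar>) \<and>
     (\<forall>t. \<Omega> t \<subseteq> {0..b} \<times> {0..b} \<and>
          \<Omega> t \<noteq> {} \<and> closed (\<Omega> t) \<and> convex (\<Omega> t) \<and>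
          (\<forall>x\<in>{0..b}. \<exists>y\<in>{0..b}. (x, y) \<in> \<Omega> t))"

definition feasible :: "real \<Rightarrow> (nat \<Rightarrow> (real \<times> real) set) \<Rightarrow> real \<Rightarrow> (nat \<Rightarrow> real) set" where
  "feasible b \<Omega> x =
     {xs. (\<forall>t. xs t \<in> {0..b}) \<and> xs 0 = x \<and> (\<forall>t. (xs t, xs (Suc t)) \<in> \<Omega> t)}"

text \<open>
  For an LDO problem the two series below converge absolutely, because feasible sequences
  are bounded.
\<close>

definition solutions ::
    "real \<Rightarrow> (nat \<Rightarrow> real) \<Rightarrow> (nat \<Rightarrow> (real \<times> real) set) \<Rightarrow> real \<Rightarrow> (nat \<Rightarrow> real) set" where
  "solutions b p \<Omega> x =
     {xs \<in> feasible b \<Omega> x. \<forall>ys \<in> feasible b \<Omega> x. (\<Sum>t. p t * xs t) \<ge> (\<Sum>t. p t * ys t)}"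

end

theory Submission
  imports Defs
begin

text \<open>
  Summing the support inequality (i) along a competing sequence \<open>ys\<close> with the same starting
  point telescopes to \<open>q n * (xs n - ys n)\<close>, which is at most \<open>q n * xs n\<close> since
  \<open>q\<close> and \<open>ys\<close> are non-negative; this bound tends to \<open>0\<close>.
\<close>

text \<open>Entries of a feasible sequence lie in \<open>{0..b}\<close>, so
  \<open>\<bar>p t\<bar> * b\<close> dominates the terms. This makes the objective values genuine
  limits of partial sums.\<close>

lemma feasible_summable:
  assumes "LDO_problem b p \<Omega>" and "zs \<in> feasible b \<Omega> x"
  shows "summable (\<lambda>t. p t * zs t)"
proof (rule summable_comparison_test')
  show "summable (\<lambda>t. \<bar>p t\<bar> * b)"
    using assms(1) by (auto simp: LDO_problem_def intro: summable_mult2)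
  show "norm (p t * zs t) \<le> \<bar>p t\<bar> * b" if "t \<ge> 0" for t
    using assms(2) by (auto simp: feasible_def abs_mult intro!: mult_left_mono)
qed

text \<open>Rearranged, the inequality bounds the summand at \<open>t\<close> by the increment of
  \<open>q t * (xs t - ys t)\<close> from \<open>t\<close> to \<open>Suc t\<close>. The equal
  starting points make the boundary term at \<open>0\<close> vanish.\<close>

lemma partial_sum_diff_le:
  fixes p q xs ys :: "nat \<Rightarrow> real"
  assumes "xs 0 = ys 0"
    and "\<And>t. p t * xs t + q (Suc t) * xs (Suc t) - q t * xs t
               \<ge> p t * ys t + q (Suc t) * ys (Suc t) - q t * ys t"
  shows "(\<Sum>t<n. p t * ys t - p t * xs t) \<le> q n * (xs n - ys n)"
proof (induction n)
  case 0
  then show ?case using assms(1) by simp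
next
  case (Suc n)
  then show ?case using assms(2)[of n] by (simp add: algebra_simps)
qed


theorem proposition3p2:
  fixes b x :: real and p :: "nat \<Rightarrow> real" and \<Omega> :: "nat \<Rightarrow> (real \<times> real) set"
    and xs :: "nat \<Rightarrow> real"
  assumes "b > 0"
    and "LDO_problem b p \<Omega>"
    and "x \<in> {0..b}"
    and "xs \<in> feasible b \<Omega> x"
    and "\<exists>q :: nat \<Rightarrow> real. (\<forall>t. q t \<ge> 0) \<and>
           (\<forall>t. \<forall>(y, z) \<in> \<Omega> t.
              p t * xs t + q (Suc t) * xs (Suc t) - q t * xs t
                \<ge> p t * y + q (Suc t) * z - q t * y) \<and>
           (\<lambda>t. q t * xs t) \<longlonglongrightarrow> 0"
  shows "xs \<in> solutions b p \<Omega> x"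
proof -
  obtain q :: "nat \<Rightarrow> real" where q_nonneg: "\<And>t. q t \<ge> 0"
    and support: "\<And>t y z. (y, z) \<in> \<Omega> t \<Longrightarrow>
          p t * xs t + q (Suc t) * xs (Suc t) - q t * xs t
            \<ge> p t * y + q (Suc t) * z - q t * y"
    and lim: "(\<lambda>t. q t * xs t) \<longlonglongrightarrow> 0"
    using assms(5) by blast
  have "(\<Sum>t. p t * ys t) \<le> (\<Sum>t. p t * xs t)" if ys: "ys \<in> feasible b \<Omega> x" for ys
  proof -
    have "(\<lambda>t. p t * ys t - p t * xs t) sums ((\<Sum>t. p t * ys t) - (\<Sum>t. p t * xs t))"
      by (intro sums_diff summable_sums feasible_summable[OF assms(2) ys]
          feasible_summable[OF assms(2,4)])
    then have "(\<lambda>n. \<Sum>t<n. p t * ys t - p t * xs t)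
        \<longlonglongrightarrow> (\<Sum>t. p t * ys t) - (\<Sum>t. p t * xs t)"
      by (simp add: sums_def)
    moreover have "(\<Sum>t<n. p t * ys t - p t * xs t) \<le> q n * xs n" for n
    proof -
      \<comment> \<open>Feasibility of \<open>ys\<close> allows \<open>support\<close> to be applied
        at \<open>(ys t, ys (Suc t))\<close>.\<close>
      have "(\<Sum>t<n. p t * ys t - p t * xs t) \<le> q n * (xs n - ys n)"
        using ys assms(4) support by (intro partial_sum_diff_le) (auto simp: feasible_def)
      \<comment> \<open>Dropping \<open>q n * ys n\<close> frees the bound of the competitor, so
        \<open>lim\<close>, which concerns \<open>xs\<close> alone, controls it.\<close>
      also have "\<dots> \<le> q n * xs n"
        using ys q_nonneg by (intro mult_left_mono) (auto simp: feasible_def)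
      finally show ?thesis .
    qed
    ultimately have "(\<Sum>t. p t * ys t) - (\<Sum>t. p t * xs t) \<le> 0"
      using lim by (intro LIMSEQ_le) auto
    then show ?thesis by simp
  qed
  then show ?thesis
    using assms(4) by (simp add: solutions_def)
qed

end
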